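(* Let $\mathcal{G}$ be the path graph with one branch on $n$ vertices, let $S\subseteq\{2,\ldots,n\}$ with $s:=|S|$, and let an admissible decomposition of $\mathcal{G}$ into three path graphs with segment lengths $d^i_j$ be given, together with integers $u^i_j$ satisfying $2\le u^i_j\le d^i_j-2$ for $j\in\{2,\ldots,s_i\}$, $i\in\{1,2,3\}$. Then the compatibility constant satisfies $$\kappa^2(S)\ge\frac{s+1}{n}\frac{1}{K^b},\qquad K^b=\sum_{i=1}^3\left(\frac{1}{d^i_1}+\sum_{j=2}^{s_i}\left(\frac{1}{u^i_j}+\frac{1}{d^i_j-u^i_j}\right)+\frac{1}{d^i_{s_i+1}}\right).$$
   Context: Branched path graph: $n=n_1+n_2$ vertices $1,\ldots,n$; edges $(i-1,i)$ for $2\le i\le n_1$ (main branch), $(b,n_1+1)$ with $1\le b<n_1$, and $(i-1,i)$ for $n_1+2\le i\le n$ (side branch). It is rooted at vertex $1$, each vertex $i\ge2$ has a parent (its neighbour towards the root), and the edge from the parent to $i$ is indexed by $i$; thus $S\subseteq\{2,\ldots,n\}$ is a set of edges. Path matrix: $X\in\mathbb{R}^{n\times n}$, $X_{ij}=1$ if $j$ lies on the path from $1$ to $i$ (endpoints included), $0$ otherwise. Compatibility constant: with $\|v\|_n^2=\frac1n\sum_iv_i^2$, $$\kappa^2(S):=\min\{(s+1)\|X\beta\|_n^2:\ \beta\in\mathbb{R}^n,\ \|\beta_S\|_1-\|\beta_{-(\{1\}\cup S)}\|_1=1\},$$ where $-(\{1\}\cup S)$ denotes the complement in $\{1,\ldots,n\}$.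 Admissible decomposition: $S$ is partitioned as $S_1=S\cap\{2,\ldots,b\}$, $S_2=S\cap\{b+1,\ldots,n_1\}$, $S_3=S\cap\{n_1+1,\ldots,n\}$, with $s_i=|S_i|\ge1$. By removing two edges not in $S$, the graph is decomposed into three vertex-disjoint path graphs $P^1,P^2,P^3$ covering all vertices, such that $P^i$ contains exactly the edges of $S$ lying in $S_i$; $P^1$ starts at vertex $1$, $P^2$ ends at vertex $n_1$, $P^3$ ends at vertex $n$. (The end of $P^1$ need not be $b$, and the starting points of $P^2,P^3$ need not be $b+1,n_1+1$.) Traversing $P^i$ in this direction, removal of the edges in $S_i$ cuts $P^i$ into $s_i+1$ consecutive segments with $d^i_1,\ldots,d^i_{s_i+1}$ vertices (so $\sum_i\sum_jd^i_j=n$). It is required that $d^i_1\ge2$, $d^i_{s_i+1}\ge2$ and $d^i_j\ge4$ for $2\le j\le s_i$, for every $i$. *)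

theory Defs
  imports "HOL-Analysis.Analysis"
begin

text \<open>
  The path graph with one branch has vertices \<open>{1..n1 + n2}\<close>. Undirected edges are two-element sets
  of vertices. Throughout, \<open>1 \<le> b < n1\<close> and \<open>1 \<le> n2\<close> are intended.
\<close>

definition branched_edges :: "nat \<Rightarrow> nat \<Rightarrow> nat \<Rightarrow> nat set set" where
  "branched_edges n1 n2 b =
     {{i - 1, i} |i. 2 \<le> i \<and> i \<le> n1} \<union> {{b, n1 + 1}} \<union> {{i - 1, i} |i. n1 + 2 \<le> i \<and> i \<le> n1 + n2}"

definition parent :: "nat \<Rightarrow> nat \<Rightarrow> nat \<Rightarrow> nat" where
  "parent n1 b i = (if i = n1 + 1 then b else i - 1)"

text \<open>The edge with index \<open>i\<close>, for \<open>i \<in> {2..n1 + n2}\<close>.\<close>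

definition edge :: "nat \<Rightarrow> nat \<Rightarrow> nat \<Rightarrow> nat set" where
  "edge n1 b i = {parent n1 b i, i}"

lemma branched_edges_eq_image:
  assumes "b < n1" "1 \<le> n2"
  shows "branched_edges n1 n2 b = edge n1 b ` {2..n1 + n2}"
proof -
  have "{2..n1 + n2} = {2..n1} \<union> {n1 + 1} \<union> {n1 + 2..n1 + n2}"
    using assms by auto
  moreover have "edge n1 b ` {2..n1} = {{i - 1, i} |i. 2 \<le> i \<and> i \<le> n1}"
    by (force simp: edge_def parent_def image_def)
  moreover have "edge n1 b ` {n1 + 2..n1 + n2} = {{i - 1, i} |i. n1 + 2 \<le> i \<and> i \<le> n1 + n2}"
    by (force simp: edge_def parent_def image_def)
  ultimately show ?thesis
    by (simp add: branched_edges_def image_Un edge_def parent_def)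
qed

definition is_path :: "nat set \<Rightarrow> nat set set \<Rightarrow> nat list \<Rightarrow> bool" where
  "is_path V E xs \<longleftrightarrow>
     xs \<noteq> [] \<and> set xs \<subseteq> V \<and> distinct xs \<and> successively (\<lambda>x y. {x, y} \<in> E) xs"

definition root_path :: "nat \<Rightarrow> nat \<Rightarrow> nat \<Rightarrow> nat \<Rightarrow> nat list \<Rightarrow> bool" where
  "root_path n1 n2 b i xs \<longleftrightarrow>
     is_path {1..n1 + n2} (branched_edges n1 n2 b) xs \<and> hd xs = 1 \<and> last xs = i"

text \<open>
  The graph is a tree, so the path from \<open>1\<close> to \<open>i\<close> that is quantified over here is unique.
\<close>

definition path_matrix :: "nat \<Rightarrow> nat \<Rightarrow> nat \<Rightarrow> nat \<Rightarrow> nat \<Rightarrow> real" where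
  "path_matrix n1 n2 b i j =
     (if \<exists>xs. root_path n1 n2 b i xs \<and> j \<in> set xs then 1 else 0)"

text \<open>
  Vectors of length \<open>n\<close> are functions on \<open>{1..n}\<close>; their values elsewhere are never used.
\<close>

definition mat_vec :: "nat \<Rightarrow> (nat \<Rightarrow> nat \<Rightarrow> real) \<Rightarrow> (nat \<Rightarrow> real) \<Rightarrow> nat \<Rightarrow> real" where
  "mat_vec n A v i = (\<Sum>j\<in>{1..n}. A i j * v j)"

definition norm_n_sq :: "nat \<Rightarrow> (nat \<Rightarrow> real) \<Rightarrow> real" where
  "norm_n_sq n v = 1 / real n * (\<Sum>i\<in>{1..n}. (v i)\<^sup>2)"

definition l1_on :: "nat set \<Rightarrow> (nat \<Rightarrow> real) \<Rightarrow> real" where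
  "l1_on A v = (\<Sum>i\<in>A. \<bar>v i\<bar>)"

definition kappa_values :: "nat \<Rightarrow> nat \<Rightarrow> nat \<Rightarrow> nat set \<Rightarrow> real set" where
  "kappa_values n1 n2 b S =
     {real (card S + 1) * norm_n_sq (n1 + n2) (mat_vec (n1 + n2) (path_matrix n1 n2 b) \<beta>) |\<beta>.
        l1_on S \<beta> - l1_on ({1..n1 + n2} - ({1} \<union> S)) \<beta> = 1}"

text \<open>
  The squared compatibility constant. For nonempty \<open>S\<close> the infimum is a minimum, see
  \<open>kappa_sq_is_minimum\<close> below.
\<close>

definition kappa_sq :: "nat \<Rightarrow> nat \<Rightarrow> nat \<Rightarrow> nat set \<Rightarrow> real" where
  "kappa_sq n1 n2 b S = Inf (kappa_values n1 n2 b S)"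

definition path_edges :: "nat list \<Rightarrow> nat set set" where
  "path_edges xs = set (map (\<lambda>(x, y). {x, y}) (zip xs (tl xs)))"

definition S_part :: "nat \<Rightarrow> nat \<Rightarrow> nat \<Rightarrow> nat set \<Rightarrow> nat \<Rightarrow> nat set" where
  "S_part n1 n2 b S i =
     S \<inter> (if i = 1 then {2..b} else if i = 2 then {b + 1..n1} else {n1 + 1..n1 + n2})"

text \<open>
  Cuts a path, traversed in list order, at its edges in \<open>T\<close> into consecutive segments.
\<close>

fun segments :: "nat set set \<Rightarrow> nat list \<Rightarrow> nat list list" where
  "segments T [] = []"
| "segments T [x] = [[x]]"
| "segments T (x # y # xs) =
     (if {x, y} \<in> T then [x] # segments T (y # xs)
      else (x # hd (segments T (y # xs))) # tl (segments T (y # xs)))"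

text \<open>
  \<open>P i\<close> lists the vertices of the \<open>i\<close>th path in its direction of traversal, and \<open>d i j\<close>
  is the number of vertices of its \<open>j\<close>th segment. \<open>F\<close> holds the indices of the removed
  edges; what remains of the graph is exactly the union of the three paths.
\<close>

definition admissible_decomposition ::
    "nat \<Rightarrow> nat \<Rightarrow> nat \<Rightarrow> nat set \<Rightarrow> (nat \<Rightarrow> nat list) \<Rightarrow> (nat \<Rightarrow> nat \<Rightarrow> nat) \<Rightarrow> bool" where
  "admissible_decomposition n1 n2 b S P d \<longleftrightarrow>
     (\<forall>i\<in>{1..3}. 1 \<le> card (S_part n1 n2 b S i)) \<and>
     (\<exists>F. F \<subseteq> {2..n1 + n2} - S \<and> card F = 2 \<and>
        edge n1 b ` ({2..n1 + n2} - F) = (\<Union>i\<in>{1..3}. path_edges (P i))) \<and>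
     (\<forall>i\<in>{1..3}. is_path {1..n1 + n2} (branched_edges n1 n2 b) (P i)) \<and>
     disjoint_family_on (\<lambda>i. set (P i)) {1..3} \<and>
     (\<Union>i\<in>{1..3}. set (P i)) = {1..n1 + n2} \<and>
     (\<forall>i\<in>{1..3}. {e\<in>S. edge n1 b e \<in> path_edges (P i)} = S_part n1 n2 b S i) \<and>
     hd (P 1) = 1 \<and> last (P 2) = n1 \<and> last (P 3) = n1 + n2 \<and>
     (\<forall>i\<in>{1..3}. map (d i) [1..<card (S_part n1 n2 b S i) + 2] =
        map length (segments (edge n1 b ` S_part n1 n2 b S i) (P i))) \<and>
     (\<forall>i\<in>{1..3}. 2 \<le> d i 1 \<and> 2 \<le> d i (card (S_part n1 n2 b S i) + 1) \<and>
        (\<forall>j\<in>{2..card (S_part n1 n2 b S i)}. 4 \<le> d i j))"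

context
  fixes n1 n2 b :: nat
  assumes b: "1 \<le> b" "b < n1" and n2: "1 \<le> n2"
begin

lemma parent_less: "2 \<le> i \<Longrightarrow> parent n1 b i < i" "2 \<le> i \<Longrightarrow> 1 \<le> parent n1 b i"
  using b by (auto simp: parent_def)

lemma rootpath_step:
  assumes "root_path n1 n2 b i xs" "Suc k < length xs"
  shows "2 \<le> xs ! Suc k \<and> xs ! k = parent n1 b (xs ! Suc k)"
  using assms(2)
proof (induction k)
  case 0
  then have "{xs ! 0, xs ! Suc 0} \<in> edge n1 b ` {2..n1+n2}"
    using assms(1) b n2 by (auto simp: root_path_def is_path_def branched_edges_eq_image successively_conv_nth)
  moreover have "xs ! 0 = 1" using assms(1) by (auto simp: root_path_def is_path_def hd_conv_nth)
  ultimately show ?case by (auto simp: edge_def doubleton_eq_iff)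
next
  case (Suc k)
  then have "{xs ! Suc k, xs ! Suc (Suc k)} \<in> edge n1 b ` {2..n1+n2}"
    using assms(1) b n2 by (auto simp: root_path_def is_path_def branched_edges_eq_image successively_conv_nth)
  then obtain e where e: "2 \<le> e" "{xs ! Suc k, xs ! Suc (Suc k)} = {parent n1 b e, e}" by (auto simp: edge_def)
  have "distinct xs" using assms(1) by (auto simp: root_path_def is_path_def)
  then have "xs ! k \<noteq> xs ! Suc (Suc k)" using Suc.prems by (simp add: nth_eq_iff_index_eq)
  with e Suc show ?case by (auto simp: doubleton_eq_iff)
qed

lemma rootpath_le: assumes "root_path n1 n2 b i xs" "j \<in> set xs" shows "j \<le> i"
proof -
  have "sorted_wrt (<) xs"
    using rootpath_step[OF assms(1)] parent_less(1)
    by (subst sorted_wrt_iff_nth_Suc_transp) auto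
  then have "sorted xs" by (simp add: strict_sorted_imp_sorted)
  moreover obtain k where "k < length xs" "j = xs ! k" using assms(2) by (auto simp: in_set_conv_nth)
  ultimately show ?thesis using assms by (auto simp: root_path_def is_path_def last_conv_nth intro!: sorted_nth_mono)
qed

lemma rootpath_snoc:
  assumes "2 \<le> i" "i \<le> n1 + n2" "root_path n1 n2 b (parent n1 b i) xs"
  shows "root_path n1 n2 b i (xs @ [i])"
proof -
  have "i \<notin> set xs" using rootpath_le[OF assms(3)] parent_less(1)[OF assms(1)] by force
  moreover have "{parent n1 b i, i} \<in> branched_edges n1 n2 b"
    using assms b n2 by (auto simp: branched_edges_eq_image edge_def)
  ultimately show ?thesis using assms
    by (auto simp: root_path_def is_path_def successively_append_iff)
qed

lemma rootpath_butlast: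
  assumes "2 \<le> i" "root_path n1 n2 b i xs"
  shows "root_path n1 n2 b (parent n1 b i) (butlast xs) \<and> set xs = insert i (set (butlast xs))"
proof -
  have ne: "xs \<noteq> []" and l: "last xs = i" "hd xs = 1" using assms by (auto simp: root_path_def is_path_def)
  obtain ys where ys: "xs = ys @ [i]" using ne l by (metis append_butlast_last_id)
  have "ys \<noteq> []" using l ys assms(1) by auto
  then obtain zs p where zs: "ys = zs @ [p]" by (metis append_butlast_last_id)
  have "p = parent n1 b i"
    using rootpath_step[OF assms(2), of "length zs"] ys zs by (simp add: nth_append)
  moreover have "butlast xs = ys" unfolding ys by simp
  moreover have "hd ys = 1" using l(2) \<open>ys \<noteq> []\<close> unfolding ys by simp
  moreover have "last ys = p" unfolding zs by simp
  moreover have "is_path {1..n1 + n2} (branched_edges n1 n2 b) ys"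
    using assms(2) \<open>ys \<noteq> []\<close> unfolding root_path_def is_path_def ys by (simp add: successively_append_iff)
  ultimately show ?thesis using ys by (simp add: root_path_def)
qed

lemma rootpath_ex: "1 \<le> i \<Longrightarrow> i \<le> n1 + n2 \<Longrightarrow> \<exists>xs. root_path n1 n2 b i xs"
proof (induction i rule: less_induct)
  case (less i)
  show ?case
  proof (cases "i = 1")
    case True
    have "root_path n1 n2 b 1 [1]" using b by (auto simp: root_path_def is_path_def)
    with True show ?thesis by blast
  next
    case False
    then have "2 \<le> i" using less by auto
    then show ?thesis using less.IH[of "parent n1 b i"] parent_less[of i] rootpath_snoc[of i] less.prems
      by (meson le_trans less_imp_le_nat)
  qed
qed

lemma mat_vec_one: "mat_vec (n1+n2) (path_matrix n1 n2 b) v 1 = v 1"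
proof -
  obtain xs where xs: "root_path n1 n2 b 1 xs" using rootpath_ex[of 1] b by auto
  then have "1 \<in> set xs" by (metis hd_in_set is_path_def root_path_def)
  then have "(\<exists>xs. root_path n1 n2 b 1 xs \<and> j \<in> set xs) \<longleftrightarrow> j = 1" if "j \<in> {1..n1 + n2}" for j
    using xs rootpath_le that by (metis atLeastAtMost_iff le_antisym)
  then have "path_matrix n1 n2 b 1 j = (if j = 1 then 1 else 0)" if "j \<in> {1..n1 + n2}" for j
    using that by (simp add: path_matrix_def)
  then have "mat_vec (n1+n2) (path_matrix n1 n2 b) v 1 = (\<Sum>j\<in>{1..n1+n2}. if j = 1 then v j else 0)"
    unfolding mat_vec_def by (intro sum.cong) auto
  then show ?thesis using b by simp
qed

lemma mat_vec_step:
  assumes "2 \<le> i" "i \<le> n1 + n2"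
  shows "mat_vec (n1+n2) (path_matrix n1 n2 b) v i = mat_vec (n1+n2) (path_matrix n1 n2 b) v (parent n1 b i) + v i"
proof -
  have X: "path_matrix n1 n2 b i j = (if \<exists>xs. root_path n1 n2 b i xs \<and> j \<in> set xs then 1 else 0)" for i j
    by (simp add: path_matrix_def)
  have "path_matrix n1 n2 b i j = path_matrix n1 n2 b (parent n1 b i) j + (if j = i then 1 else 0)" for j
  proof (cases "j = i")
    case True
    have "\<exists>xs. root_path n1 n2 b i xs \<and> i \<in> set xs"
      using rootpath_ex[of i] assms by (auto simp: root_path_def is_path_def)
    moreover have "\<not> (\<exists>xs. root_path n1 n2 b (parent n1 b i) xs \<and> i \<in> set xs)"
      using rootpath_le[of "parent n1 b i" _ i] parent_less(1)[OF assms(1)] by force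
    ultimately show ?thesis using True by (simp add: X)
  next
    case False
    have "(\<exists>xs. root_path n1 n2 b i xs \<and> j \<in> set xs) \<longleftrightarrow> (\<exists>xs. root_path n1 n2 b (parent n1 b i) xs \<and> j \<in> set xs)"
      using False rootpath_butlast[OF assms(1)] rootpath_snoc[OF assms]
      by (metis Un_iff insert_iff set_append)
    then show ?thesis using False by (simp add: X)
  qed
  then have "mat_vec (n1+n2) (path_matrix n1 n2 b) v i = (\<Sum>j\<in>{1..n1+n2}. path_matrix n1 n2 b (parent n1 b i) j * v j + (if j = i then v j else 0))"
    unfolding mat_vec_def by (intro sum.cong) (auto simp: algebra_simps)
  then show ?thesis using assms by (simp add: mat_vec_def sum.distrib)
qed

lemma kappa_sq_is_minimum:
  assumes S: "S \<subseteq> {2..n1 + n2}" "S \<noteq> {}"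
  shows "kappa_sq n1 n2 b S \<in> kappa_values n1 n2 b S"
    "\<And>x. x \<in> kappa_values n1 n2 b S \<Longrightarrow> kappa_sq n1 n2 b S \<le> x"
proof -
  define n where "n = n1 + n2"
  define f where "f = mat_vec n (path_matrix n1 n2 b)"
  define q where "q \<beta> = real (card S + 1) * norm_n_sq n (f \<beta>)" for \<beta>
  define g where "g \<beta> = l1_on S \<beta> - l1_on ({1..n} - ({1} \<union> S)) \<beta>" for \<beta>
  have n: "0 < n" using b by (simp add: n_def)
  have vals: "kappa_values n1 n2 b S = q ` {\<beta>. g \<beta> = 1}"
    by (auto simp: kappa_values_def q_def f_def g_def n_def)
  have norm0: "0 \<le> norm_n_sq n v" for v by (simp add: norm_n_sq_def sum_nonneg)
  then have q0: "0 \<le> q \<beta>" for \<beta> by (simp add: q_def)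
  have "continuous_on UNIV q" unfolding q_def f_def norm_n_sq_def mat_vec_def
    by (intro continuous_intros continuous_on_product_coordinates)
  have cg: "continuous_on UNIV g" unfolding g_def l1_on_def
    by (intro continuous_intros continuous_on_product_coordinates)
  obtain j where j: "j \<in> S" using S by blast
  define \<beta>0 :: "nat \<Rightarrow> real" where "\<beta>0 = (\<lambda>i. if i = j then 1 else 0)"
  have fS: "finite S" using S finite_subset by blast
  have g0: "g \<beta>0 = 1"
  proof -
    have "l1_on S \<beta>0 = (\<Sum>i\<in>S. if i = j then 1 else 0)" by (auto simp: l1_on_def \<beta>0_def intro!: sum.cong)
    moreover have "l1_on ({1..n} - ({1} \<union> S)) \<beta>0 = 0" using j by (auto simp: l1_on_def \<beta>0_def intro!: sum.neutral)
    ultimately show ?thesis using fS j by (simp add: g_def)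
  qed
  define M where "M = real n * q \<beta>0"
  define B where "B = 2 * sqrt M + 1"
  have bound: "\<bar>\<beta> i\<bar> \<le> B" if le: "q \<beta> \<le> q \<beta>0" and i: "i \<in> {1..n}" for \<beta> i
  proof -
    have "\<bar>f \<beta> k\<bar> \<le> sqrt M" if k: "k \<in> {1..n}" for k
    proof -
      have "(f \<beta> k)\<^sup>2 \<le> (\<Sum>i\<in>{1..n}. (f \<beta> i)\<^sup>2)" using k by (intro member_le_sum) auto
      also have "\<dots> = real n * norm_n_sq n (f \<beta>)" using n by (simp add: norm_n_sq_def)
      also have "\<dots> \<le> real n * q \<beta>"
      proof -
        have "norm_n_sq n (f \<beta>) \<le> q \<beta>" using norm0[of "f \<beta>"] by (simp add: q_def algebra_simps)
        then show ?thesis by (simp add: mult_left_mono)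
      qed
      also have "\<dots> \<le> M" using le by (simp add: M_def mult_left_mono)
      finally show ?thesis using real_sqrt_le_mono by fastforce
    qed note fk = this
    show ?thesis
    proof (cases "i = 1")
      case True
      have "0 \<le> sqrt M" using q0 by (simp add: M_def)
      then show ?thesis using fk[OF i] mat_vec_one[of \<beta>] True by (simp add: f_def n_def B_def)
    next
      case False
      then have i2: "2 \<le> i" "i \<le> n1 + n2" using i by (auto simp: n_def)
      have "parent n1 b i \<in> {1..n}" using parent_less[OF i2(1)] i2 by (auto simp: n_def)
      from fk[OF this] fk[OF i] mat_vec_step[OF i2, of \<beta>] show ?thesis by (simp add: f_def n_def B_def)
    qed
  qed
  define C :: "(nat \<Rightarrow> real) set" where "C = PiE UNIV (\<lambda>i. if i \<in> {1..n} then {-B..B} else {0}) \<inter> g -` {1}"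
  have "compactin (product_topology (\<lambda>_. euclidean) UNIV) (PiE UNIV (\<lambda>i. if i \<in> {1..n} then {-B..B} else {0::real}))"
    by (subst compactin_PiE) (auto simp: compactin_euclidean_iff)
  then have "compact (PiE UNIV (\<lambda>i. if i \<in> {1..n} then {-B..B} else {0::real}))"
    by (simp add: euclidean_product_topology flip: compactin_euclidean_iff)
  moreover have "closed (g -` {1})" using cg by (intro continuous_closed_vimage) (auto simp: continuous_on_eq_continuous_at)
  ultimately have C: "compact C" unfolding C_def by (rule compact_Int_closed)
  define tr where "tr \<beta> = (\<lambda>i. if i \<in> {1..n} then \<beta> i else 0)" for \<beta> :: "nat \<Rightarrow> real"
  have qtr: "q (tr \<beta>) = q \<beta>" for \<beta>
  proof -
    have "f (tr \<beta>) i = f \<beta> i" for i unfolding f_def mat_vec_def by (rule sum.cong) (auto simp: tr_def)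
    then show ?thesis by (simp add: q_def norm_n_sq_def)
  qed
  have gtr: "g (tr \<beta>) = g \<beta>" for \<beta>
  proof -
    have "S \<subseteq> {1..n}" using S by (auto simp: n_def)
    then show ?thesis by (auto simp: g_def l1_on_def tr_def intro!: arg_cong2[of _ _ _ _ "(-)"] sum.cong)
  qed
  have inC: "tr \<beta> \<in> C" if "g \<beta> = 1" "q \<beta> \<le> q \<beta>0" for \<beta>
    using that bound[OF that(2)] gtr by (fastforce simp: C_def tr_def abs_le_iff PiE_iff)
  have "C \<noteq> {}" using inC[OF g0] by auto
  then obtain m where m: "m \<in> C" "\<And>x. x \<in> C \<Longrightarrow> q m \<le> q x"
    using continuous_attains_inf[OF C] \<open>continuous_on UNIV q\<close> by (metis continuous_on_subset subset_UNIV)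
  have min: "q m \<le> q \<beta>" if "g \<beta> = 1" for \<beta>
    using m(2)[OF inC[OF that]] m(2)[OF inC[OF g0]] qtr by fastforce
  have "Inf (kappa_values n1 n2 b S) = q m"
    unfolding vals using m(1) min by (intro cInf_eq_minimum) (auto simp: C_def)
  then show "kappa_sq n1 n2 b S \<in> kappa_values n1 n2 b S"
    "\<And>x. x \<in> kappa_values n1 n2 b S \<Longrightarrow> kappa_sq n1 n2 b S \<le> x"
    using m(1) min by (auto simp: kappa_sq_def vals C_def)
qed

end

end

theory Submission
  imports Defs
begin

text \<open>
  Put \<open>f = X \<beta>\<close>. Then \<open>\<bar>\<beta> e\<bar>\<close> is the jump of \<open>f\<close> across the edge \<open>e\<close>, so the constraint says that
  the jumps of \<open>f\<close> across the edges of \<open>S\<close> exceed those across all other edges by exactly \<open>1\<close>.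
  Removing edges outside \<open>S\<close> can only increase this excess. Hence the three paths have net variations
  (jumps across edges of \<open>S\<close> minus jumps across the other edges of the path) that sum to at least \<open>1\<close>.

  On one path, cut every inner segment into a first part of \<open>u\<close> vertices and a second part of \<open>d - u\<close>
  vertices, and leave the two outer segments whole. Every edge of \<open>S\<close> on the path joins the end of one
  part to the beginning of the next, and no part is used by two edges of \<open>S\<close>. A jump is at most the
  sum of the absolute values of \<open>f\<close> at both ends, and such a value exceeds the mean of \<open>\<bar>f\<bar>\<close> over its
  part by no more than the variation of \<open>f\<close> inside the part, which the net variation subtracts again.
  So the net variation is at most the sum over all parts of the mean of \<open>\<bar>f\<bar>\<close>.

  With \<open>Q = \<Sum> (f i)\<^sup>2\<close>, Cauchy's inequality bounds these means, for all parts of the three paths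
  together, by \<open>sqrt (K * Q)\<close>, because a part with \<open>m\<close> vertices contributes \<open>m * (1 / m)\<^sup>2 = 1 / m\<close> to
  \<open>K\<close>. Hence \<open>1 \<le> K * Q\<close>. Below, Cauchy's inequality appears in the additive form
  \<open>2 * sqrt (K * Q) \<le> c * K + Q / c\<close>, which can be proved part by part and summed; the choice
  \<open>c = 1 / K\<close> gives the same conclusion.
  The lemmas that carry this are \<open>abs_le_variation_plus_mean\<close> (one part), \<open>net_variation_le\<close>
  (one path) and \<open>excess_le_net_variations\<close> (from the graph to the paths).
\<close>

section \<open>Variation along a list of vertices\<close>

fun variation :: "('a \<Rightarrow> real) \<Rightarrow> 'a list \<Rightarrow> real" where
  "variation f (x # y # xs) = \<bar>f x - f y\<bar> + variation f (y # xs)"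
| "variation f _ = 0"

lemma variation_nonneg: "0 \<le> variation f xs"
  by (induction f xs rule: variation.induct) auto

lemma abs_diff_hd_le_variation: "z \<in> set (x # xs) \<Longrightarrow> \<bar>f x - f z\<bar> \<le> variation f (x # xs)"
proof (induction xs arbitrary: x)
  case (Cons y xs)
  show ?case
  proof (cases "z = x")
    case True
    then show ?thesis by (simp add: variation_nonneg)
  next
    case False
    then have "\<bar>f y - f z\<bar> \<le> variation f (y # xs)" using Cons by simp
    then show ?thesis by simp
  qed
qed simp

lemma abs_diff_le_variation:
  "x \<in> set xs \<Longrightarrow> z \<in> set xs \<Longrightarrow> \<bar>f x - f z\<bar> \<le> variation f xs"
proof (induction f xs rule: variation.induct)
  case (1 f v y xs)
  consider "x = v" | "z = v" | "x \<in> set (y # xs)" "z \<in> set (y # xs)"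
    using 1 by auto
  then show ?case
  proof cases
    case 1
    then show ?thesis
      using abs_diff_hd_le_variation[of z v "y # xs" f] "1.prems" by simp
  next
    case 2
    then show ?thesis
      using abs_diff_hd_le_variation[of x v "y # xs" f] "1.prems" by (simp add: abs_minus_commute)
  next
    case 3
    then show ?thesis using "1.IH" by fastforce
  qed
qed auto

lemma variation_append: "variation f xs + variation f ys \<le> variation f (xs @ ys)"
proof (induction f xs rule: variation.induct)
  case ("2_2" f v)
  then show ?case by (cases ys) auto
qed auto

text \<open>
  The value at \<open>x\<close> exceeds \<open>\<bar>f z\<bar>\<close> by at most the variation, for every \<open>z\<close> on the list; averaging
  over the \<open>m\<close> entries and using \<open>2 * \<bar>f z\<bar> \<le> c / m + m * (f z)\<^sup>2 / c\<close> gives the bound.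
\<close>

lemma abs_le_variation_plus_mean:
  assumes "x \<in> set xs" "0 < c"
  shows "2 * \<bar>f x\<bar> \<le> 2 * variation f xs + c / length xs + (\<Sum>z\<leftarrow>xs. (f z)\<^sup>2) / c"
proof -
  define m where "m = real (length xs)"
  have m: "0 < m" using assms(1) by (cases xs) (auto simp: m_def)
  have "2 * \<bar>f x\<bar> \<le> 2 * variation f xs + c / m + m / c * (f z)\<^sup>2" if "z \<in> set xs" for z
  proof -
    have "0 \<le> (c - m * \<bar>f z\<bar>)\<^sup>2" by simp
    then have "2 * \<bar>f z\<bar> * (m * c) \<le> c\<^sup>2 + m\<^sup>2 * (f z)\<^sup>2"
      by (simp add: power2_diff power_mult_distrib algebra_simps)
    then have "2 * \<bar>f z\<bar> \<le> (c\<^sup>2 + m\<^sup>2 * (f z)\<^sup>2) / (m * c)"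
      using m assms(2) by (simp add: pos_le_divide_eq)
    also have "\<dots> = c / m + m / c * (f z)\<^sup>2"
      using m assms(2) by (simp add: field_simps power2_eq_square)
    finally show ?thesis
      using abs_diff_le_variation[OF assms(1) that, of f] by linarith
  qed
  then have "(\<Sum>z\<leftarrow>xs. 2 * \<bar>f x\<bar>) \<le> (\<Sum>z\<leftarrow>xs. (2 * variation f xs + c / m) + m / c * (f z)\<^sup>2)"
    by (intro sum_list_mono) auto
  also have "\<dots> = m * (2 * variation f xs + c / m) + m / c * (\<Sum>z\<leftarrow>xs. (f z)\<^sup>2)"
    by (simp only: sum_list_addf sum_list_const_mult sum_list_triv m_def distrib_left)
  also have "\<dots> = m * (2 * variation f xs + c / m + (\<Sum>z\<leftarrow>xs. (f z)\<^sup>2) / c)"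
    by (simp add: algebra_simps)
  finally show ?thesis using m by (simp add: sum_list_triv m_def)
qed

text \<open>
  An inner segment is charged at both ends. Splitting it after \<open>v\<close> vertices makes the two ends use
  disjoint parts, so its variation has to pay for each edge only once.
\<close>

lemma abs_ends_le_variation_plus_means:
  assumes "0 < v" "v < length xs" "0 < c"
  shows "2 * (\<bar>f (hd xs)\<bar> + \<bar>f (last xs)\<bar>)
    \<le> 2 * variation f xs + c * (1 / real v + 1 / (real (length xs) - real v))
      + (\<Sum>z\<leftarrow>xs. (f z)\<^sup>2) / c"
proof -
  define ys zs where "ys = take v xs" and "zs = drop v xs"
  have xs: "xs = ys @ zs" and len: "length ys = v" "length zs = length xs - v"
    using assms by (auto simp: ys_def zs_def)
  have ne: "ys \<noteq> []" "zs \<noteq> []" using assms by (auto simp: ys_def zs_def)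
  have ends: "hd xs = hd ys" "last xs = last zs" using ne by (simp_all add: xs)
  have "2 * \<bar>f (hd ys)\<bar> \<le> 2 * variation f ys + c / v + (\<Sum>z\<leftarrow>ys. (f z)\<^sup>2) / c"
    using abs_le_variation_plus_mean[of "hd ys" ys c f] ne assms(3) len by simp
  moreover have "2 * \<bar>f (last zs)\<bar>
      \<le> 2 * variation f zs + c / (real (length xs) - real v) + (\<Sum>z\<leftarrow>zs. (f z)\<^sup>2) / c"
    using abs_le_variation_plus_mean[of "last zs" zs c f] ne assms len by (simp add: of_nat_diff)
  moreover have "(\<Sum>z\<leftarrow>xs. (f z)\<^sup>2) / c = (\<Sum>z\<leftarrow>ys. (f z)\<^sup>2) / c + (\<Sum>z\<leftarrow>zs. (f z)\<^sup>2) / c"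
    by (simp add: xs add_divide_distrib)
  moreover have "variation f ys + variation f zs \<le> variation f xs"
    unfolding xs by (rule variation_append)
  moreover have "c * (1 / real v + 1 / (real (length xs) - real v))
      = c / v + c / (real (length xs) - real v)"
    by (simp add: algebra_simps)
  ultimately show ?thesis unfolding ends by argo
qed

section \<open>Net variation along a path\<close>

text \<open>The jump of \<open>f\<close> across an edge, in a form that does not refer to an orientation of the edge.\<close>

definition jump :: "('a \<Rightarrow> real) \<Rightarrow> 'a set \<Rightarrow> real" where
  "jump f E = Max (f ` E) - Min (f ` E)"

lemma jump_doubleton [simp]: "jump f {x, y} = \<bar>f x - f y\<bar>"
  by (auto simp: jump_def max_def min_def)

definition net_variation :: "(nat \<Rightarrow> real) \<Rightarrow> nat set set \<Rightarrow> nat list \<Rightarrow> real" where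
  "net_variation f T xs = (\<Sum>E\<in>path_edges xs. if E \<in> T then jump f E else - jump f E)"

lemma path_edges_simps [simp]:
  "path_edges [] = {}"
  "path_edges [x] = {}"
  "path_edges (x # y # xs) = insert {x, y} (path_edges (y # xs))"
  by (simp_all add: path_edges_def)

lemma path_edges_subset: "E \<in> path_edges xs \<Longrightarrow> E \<subseteq> set xs"
  by (induction xs rule: induct_list012) auto

lemma net_variation_Cons:
  assumes "distinct (x # y # xs)"
  shows "net_variation f T (x # y # xs)
    = (if {x, y} \<in> T then \<bar>f x - f y\<bar> else - \<bar>f x - f y\<bar>) + net_variation f T (y # xs)"
proof -
  have "{x, y} \<notin> path_edges (y # xs)"
    using path_edges_subset[of "{x, y}" "y # xs"] assms by auto
  moreover have "finite (path_edges (y # xs))"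
    by (simp add: path_edges_def)
  ultimately show ?thesis by (simp add: net_variation_def)
qed

lemma segments_nonempty: "xs \<noteq> [] \<Longrightarrow> segments T xs \<noteq> []"
  by (induction T xs rule: segments.induct) auto

lemma hd_segments: "xs \<noteq> [] \<Longrightarrow> hd (segments T xs) \<noteq> [] \<and> hd (hd (segments T xs)) = hd xs"
  by (induction T xs rule: segments.induct) auto

lemma concat_segments: "concat (segments T xs) = xs"
proof (induction T xs rule: segments.induct)
  case (3 T x y xs)
  show ?case
    using 3 segments_nonempty[of "y # xs" T] by (cases "segments T (y # xs)") auto
qed auto

lemma Nil_notin_segments: "[] \<notin> set (segments T xs)"
proof (induction T xs rule: segments.induct)
  case (3 T x y xs)
  show ?case
    using 3 segments_nonempty[of "y # xs" T] by (cases "segments T (y # xs)") auto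
qed auto

text \<open>
  Edges inside a segment are not in \<open>T\<close> and contribute negatively; an edge of \<open>T\<close> leads from the last
  vertex of a segment to the first vertex of the next one.
\<close>

lemma net_variation_le_segment_ends:
  assumes "xs \<noteq> []" "distinct xs"
  shows "net_variation f T xs \<le>
    (\<Sum>s\<leftarrow>butlast (segments T xs). \<bar>f (last s)\<bar>) + (\<Sum>s\<leftarrow>tl (segments T xs). \<bar>f (hd s)\<bar>)
    - (\<Sum>s\<leftarrow>segments T xs. variation f s)"
  using assms
proof (induction T xs rule: segments.induct)
  case (2 T x)
  then show ?case by (simp add: net_variation_def)
next
  case (3 T x y xs)
  obtain a ss where ss: "segments T (y # xs) = a # ss"
    using segments_nonempty[of "y # xs" T] by (cases "segments T (y # xs)") auto
  obtain as where a: "a = y # as"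
    using hd_segments[of "y # xs" T] ss by (cases a) auto
  note net = net_variation_Cons[OF "3.prems"(2), of f T]
  show ?case
  proof (cases "{x, y} \<in> T")
    case True
    then show ?thesis using "3.IH"(1)[OF True] "3.prems" net abs_triangle_ineq4[of "f x" "f y"]
      by (simp add: ss a)
  next
    case False
    then show ?thesis using "3.IH"(2)[OF False] "3.prems" net
      by (cases "ss = []") (simp_all add: ss a)
  qed
qed auto

text \<open>
  Every segment between two edges of \<open>T\<close> is charged at both ends, hence split in two parts of \<open>u j\<close> and
  \<open>d j - u j\<close> vertices. The outer segments are charged at one end only and stay whole, which gives the
  costs \<open>1 / d 1\<close> and \<open>1 / d (k + 1)\<close>. All variations cancel.
\<close>

lemma net_variation_le:
  fixes d :: "nat \<Rightarrow> nat" and u :: "nat \<Rightarrow> int"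
  assumes xs: "xs \<noteq> []" "distinct xs" and c: "0 < c" and k: "1 \<le> k"
    and d: "map d [1..<k + 2] = map length (segments T xs)"
    and u: "\<And>j. j \<in> {2..k} \<Longrightarrow> 0 < u j \<and> u j < int (d j)"
  shows "2 * net_variation f T xs
    \<le> c * (1 / d 1 + (\<Sum>j\<in>{2..k}. 1 / real_of_int (u j) + 1 / (real (d j) - real_of_int (u j)))
           + 1 / d (k + 1))
      + (\<Sum>x\<in>set xs. (f x)\<^sup>2) / c"
proof -
  define ss where "ss = segments T xs"
  define q where "q s = (\<Sum>z\<leftarrow>s. (f z)\<^sup>2) / c" for s
  define ini fin where "ini s = \<bar>f (hd s)\<bar>" and "fin s = \<bar>f (last s)\<bar>" for s
  define w where
    "w j = 1 / real_of_int (u j) + 1 / (real (d j) - real_of_int (u j))" for j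
  have len: "length ss = Suc k" using arg_cong[OF d, of length] by (simp add: ss_def del: upt_Suc)
  \<comment> \<open>\<open>d\<close> counts the segments from \<open>1\<close>, list indices start at \<open>0\<close>.\<close>
  have dj: "length (ss ! j) = d (Suc j)" if "j < Suc k" for j
  proof -
    have "map d [1..<k + 2] ! j = map length ss ! j" using d by (simp add: ss_def)
    then show ?thesis using that len by (simp del: upt_Suc)
  qed
  have ne: "ss ! j \<noteq> []" if "j < Suc k" for j
    using Nil_notin_segments[of T xs] that len unfolding ss_def[symmetric]
    by (metis nth_mem)
  have range0: "(\<Sum>j<k. g j) = g 0 + (\<Sum>j\<in>{1..<k}. g j)" for g :: "nat \<Rightarrow> real"
    using k by (simp add: lessThan_atLeast0 sum.atLeast_Suc_lessThan)
  have rangek: "(\<Sum>j<k. g (Suc j)) = (\<Sum>j\<in>{1..<k}. g j) + g k" for g :: "nat \<Rightarrow> real"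
  proof -
    have "g 0 + (\<Sum>j<k. g (Suc j)) = (\<Sum>j<k. g j) + g k"
      by (metis sum.lessThan_Suc sum.lessThan_Suc_shift)
    then show ?thesis by (simp add: range0)
  qed
  have all: "(\<Sum>s\<leftarrow>ss. g s) = g (ss ! 0) + (\<Sum>j\<in>{1..<k}. g (ss ! j)) + g (ss ! k)"
    for g :: "nat list \<Rightarrow> real"
    by (simp add: sum_list_sum_nth len lessThan_atLeast0[symmetric] range0)
  have but: "(\<Sum>s\<leftarrow>butlast ss. g s) = g (ss ! 0) + (\<Sum>j\<in>{1..<k}. g (ss ! j))"
    for g :: "nat list \<Rightarrow> real"
  proof -
    have "(\<Sum>s\<leftarrow>butlast ss. g s) = (\<Sum>j<k. g (ss ! j))"
      by (simp add: sum_list_sum_nth len lessThan_atLeast0[symmetric] nth_butlast)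
    then show ?thesis by (simp add: range0)
  qed
  have tail: "(\<Sum>s\<leftarrow>tl ss. g s) = (\<Sum>j\<in>{1..<k}. g (ss ! j)) + g (ss ! k)"
    for g :: "nat list \<Rightarrow> real"
  proof -
    have "(\<Sum>s\<leftarrow>tl ss. g s) = (\<Sum>j<k. g (ss ! Suc j))"
      by (simp add: sum_list_sum_nth len lessThan_atLeast0[symmetric] nth_tl)
    then show ?thesis using rangek[of "\<lambda>j. g (ss ! j)"] by simp
  qed
  have first: "2 * fin (ss ! 0) \<le> 2 * variation f (ss ! 0) + c / d 1 + q (ss ! 0)"
    using abs_le_variation_plus_mean[of "last (ss ! 0)" "ss ! 0" c f] ne[of 0] dj[of 0] c
    by (simp add: q_def ini_def fin_def)
  have final: "2 * ini (ss ! k) \<le> 2 * variation f (ss ! k) + c / d (k + 1) + q (ss ! k)"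
    using abs_le_variation_plus_mean[of "hd (ss ! k)" "ss ! k" c f] ne[of k] dj[of k] c
    by (simp add: q_def ini_def fin_def)
  have "2 * (ini (ss ! j) + fin (ss ! j))
      \<le> 2 * variation f (ss ! j) + c * w (Suc j) + q (ss ! j)" if "j \<in> {1..<k}" for j
  proof -
    have "0 < u (Suc j)" "u (Suc j) < int (d (Suc j))" using u[of "Suc j"] that by auto
    then show ?thesis
      using abs_ends_le_variation_plus_means[of "nat (u (Suc j))" "ss ! j" c f] dj[of j] c that
      by (simp add: q_def w_def ini_def fin_def)
  qed
  then have "(\<Sum>j\<in>{1..<k}. 2 * (ini (ss ! j) + fin (ss ! j)))
      \<le> (\<Sum>j\<in>{1..<k}. 2 * variation f (ss ! j) + c * w (Suc j) + q (ss ! j))"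
    by (rule sum_mono)
  then have inner: "2 * ((\<Sum>j\<in>{1..<k}. ini (ss ! j)) + (\<Sum>j\<in>{1..<k}. fin (ss ! j)))
      \<le> 2 * (\<Sum>j\<in>{1..<k}. variation f (ss ! j)) + c * (\<Sum>j\<in>{1..<k}. w (Suc j))
         + (\<Sum>j\<in>{1..<k}. q (ss ! j))"
    by (simp add: sum.distrib sum_distrib_left)
  have wsum: "(\<Sum>j\<in>{1..<k}. w (Suc j)) = (\<Sum>j\<in>{2..k}. w j)"
    by (rule sum.reindex_bij_witness[of _ "\<lambda>j. j - 1" Suc]) auto
  have "(\<Sum>s\<leftarrow>ss. q s) = (\<Sum>z\<leftarrow>concat ss. (f z)\<^sup>2) / c"
    by (induction ss) (simp_all add: q_def add_divide_distrib)
  also have "\<dots> = (\<Sum>x\<in>set xs. (f x)\<^sup>2) / c"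
    using xs(2) by (simp add: ss_def concat_segments sum_list_distinct_conv_sum_set)
  finally have Q: "q (ss ! 0) + (\<Sum>j\<in>{1..<k}. q (ss ! j)) + q (ss ! k) = (\<Sum>x\<in>set xs. (f x)\<^sup>2) / c"
    by (simp add: all)
  have net: "net_variation f T xs \<le>
    (\<Sum>s\<leftarrow>butlast ss. fin s) + (\<Sum>s\<leftarrow>tl ss. ini s) - (\<Sum>s\<leftarrow>ss. variation f s)"
    unfolding ss_def ini_def fin_def by (rule net_variation_le_segment_ends[OF xs])
  have cost: "c * (1 / d 1 + (\<Sum>j\<in>{2..k}. w j) + 1 / d (k + 1))
      = c / d 1 + c * (\<Sum>j\<in>{2..k}. w j) + c / d (k + 1)"
    by (simp add: algebra_simps)
  show ?thesis
    using net[unfolded all but tail] first final inner[unfolded wsum] Q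
    unfolding w_def[symmetric] cost by argo
qed

section \<open>From the branched path graph to its paths\<close>

lemma inj_on_edge:
  assumes "1 \<le> b" "b < n1"
  shows "inj_on (edge n1 b) {2..n}"
proof (rule inj_onI)
  fix x y assume "x \<in> {2..n}" "y \<in> {2..n}" and eq: "edge n1 b x = edge n1 b y"
  then have "parent n1 b x < x" "parent n1 b y < y"
    using assms by (auto simp: parent_def)
  then have "Max (edge n1 b x) = x" "Max (edge n1 b y) = y"
    by (simp_all add: edge_def)
  then show "x = y" using eq by metis
qed

text \<open>
  Every edge that is not removed lies on exactly one path, and the edges of \<open>S\<close> on the \<open>i\<close>th path are those
  with index in \<open>S_part n1 n2 b S i\<close>, so it has the same sign on both sides. The removed edges are not
  in \<open>S\<close>: they enter the left-hand side with a negative sign and can be dropped.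
\<close>

lemma excess_le_net_variations:
  fixes f \<beta> :: "nat \<Rightarrow> real"
  assumes b: "1 \<le> b" "b < n1" and S: "S \<subseteq> {2..n1 + n2}"
    and adm: "admissible_decomposition n1 n2 b S P d"
    and step: "\<And>e. e \<in> {2..n1 + n2} \<Longrightarrow> f e - f (parent n1 b e) = \<beta> e"
  shows "l1_on S \<beta> - l1_on ({1..n1 + n2} - ({1} \<union> S)) \<beta>
    \<le> (\<Sum>i\<in>{1..3}. net_variation f (edge n1 b ` S_part n1 n2 b S i) (P i))"
proof -
  let ?E = "edge n1 b" and ?V = "{2..n1 + n2}"
  \<comment> \<open>The signed jump of \<open>f\<close> across the edge with index \<open>e\<close>; \<open>A i\<close> below indexes the edges of the \<open>i\<close>th path.\<close>
  define h where "h e = (if e \<in> S then \<bar>\<beta> e\<bar> else - \<bar>\<beta> e\<bar>)" for e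
  define A where "A i = {e \<in> ?V. ?E e \<in> path_edges (P i)}" for i
  obtain F where F: "F \<subseteq> ?V - S" "?E ` (?V - F) = (\<Union>i\<in>{1..3}. path_edges (P i))"
    using adm unfolding admissible_decomposition_def by (elim conjE exE) (rule that)
  have inj: "inj_on ?E ?V" by (rule inj_on_edge[OF b])
  have "\<forall>i\<in>{1..3}. {e\<in>S. ?E e \<in> path_edges (P i)} = S_part n1 n2 b S i"
    using adm unfolding admissible_decomposition_def by (elim conjE)
  then have SA: "{e\<in>S. ?E e \<in> path_edges (P i)} = S_part n1 n2 b S i" if "i \<in> {1..3}" for i
    using that by (rule bspec)
  have img: "path_edges (P i) = ?E ` A i" if "i \<in> {1..3}" for i
  proof -
    have "path_edges (P i) \<subseteq> ?E ` (?V - F)" unfolding F(2) using that by blast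
    then show ?thesis unfolding A_def by blast
  qed
  have net: "net_variation f (?E ` S_part n1 n2 b S i) (P i) = (\<Sum>e\<in>A i. h e)"
    if i: "i \<in> {1..3}" for i
  proof -
    have injA: "inj_on ?E (A i)" by (rule inj_on_subset[OF inj]) (auto simp: A_def)
    have "?E e \<in> ?E ` S_part n1 n2 b S i \<longleftrightarrow> e \<in> S" if "e \<in> A i" for e
    proof -
      have "S_part n1 n2 b S i \<subseteq> ?V" using S by (auto simp: S_part_def)
      then have "?E e \<in> ?E ` S_part n1 n2 b S i \<longleftrightarrow> e \<in> S_part n1 n2 b S i"
        using that inj_on_image_mem_iff[OF inj] by (auto simp: A_def)
      also have "\<dots> \<longleftrightarrow> e \<in> S" using that SA[OF i] by (auto simp: A_def)
      finally show ?thesis .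
    qed
    moreover have "jump f (?E e) = \<bar>\<beta> e\<bar>" if "e \<in> A i" for e
      using step[of e] that by (auto simp: A_def edge_def abs_minus_commute)
    ultimately show ?thesis
      unfolding net_variation_def img[OF i] sum.reindex[OF injA]
      by (intro sum.cong) (auto simp: h_def)
  qed
  have disj: "A i \<inter> A j = {}" if "i \<in> {1..3}" "j \<in> {1..3}" "i \<noteq> j" for i j
  proof -
    have "disjoint_family_on (\<lambda>i. set (P i)) {1..3}"
      using adm unfolding admissible_decomposition_def by (elim conjE)
    then have "set (P i) \<inter> set (P j) = {}"
      using that by (simp add: disjoint_family_on_def)
    moreover have "A l \<subseteq> set (P l)" for l
    proof
      fix e assume "e \<in> A l"
      then have "?E e \<subseteq> set (P l)" by (intro path_edges_subset) (simp add: A_def)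
      then show "e \<in> set (P l)" by (simp add: edge_def)
    qed
    ultimately show ?thesis using subsetD unfolding disjoint_iff by metis
  qed
  have union: "(\<Union>i\<in>{1..3}. A i) = ?V - F"
  proof (intro set_eqI iffI)
    fix e assume "e \<in> (\<Union>i\<in>{1..3}. A i)"
    then obtain i where "i \<in> {1..3}" and e: "e \<in> ?V" "?E e \<in> path_edges (P i)"
      unfolding A_def by blast
    then have "?E e \<in> ?E ` (?V - F)" unfolding F(2) by blast
    then show "e \<in> ?V - F" using inj_on_image_mem_iff[OF inj e(1) Diff_subset] by blast
  next
    fix e assume e: "e \<in> ?V - F"
    then have "?E e \<in> (\<Union>i\<in>{1..3}. path_edges (P i))" unfolding F(2)[symmetric] by (rule imageI)
    then show "e \<in> (\<Union>i\<in>{1..3}. A i)" using e unfolding A_def by blast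
  qed
  have "l1_on S \<beta> = (\<Sum>e\<in>S. h e)" by (simp add: l1_on_def h_def)
  moreover have "{1..n1 + n2} - ({1} \<union> S) = ?V - S" by auto
  moreover have "l1_on (?V - S) \<beta> = - (\<Sum>e\<in>?V - S. h e)"
    by (simp add: l1_on_def h_def sum_negf)
  moreover have "(\<Sum>e\<in>?V. h e) = (\<Sum>e\<in>?V - S. h e) + (\<Sum>e\<in>S. h e)"
    using S by (intro sum.subset_diff) auto
  ultimately have "l1_on S \<beta> - l1_on ({1..n1 + n2} - ({1} \<union> S)) \<beta> = (\<Sum>e\<in>?V. h e)"
    by simp
  also have "\<dots> = (\<Sum>e\<in>?V - F. h e) + (\<Sum>e\<in>F. h e)"
    using F(1) by (intro sum.subset_diff) auto
  also have "(\<Sum>e\<in>F. h e) \<le> 0"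
    using F(1) by (intro sum_nonpos) (auto simp: h_def)
  also have "(\<Sum>e\<in>?V - F. h e) = (\<Sum>i\<in>{1..3}. \<Sum>e\<in>A i. h e)"
    unfolding union[symmetric]
  proof (rule sum.UNION_disjoint)
    show "\<forall>i\<in>{1..3}. finite (A i)" by (simp add: A_def)
    show "\<forall>i\<in>{1..3}. \<forall>j\<in>{1..3}. i \<noteq> j \<longrightarrow> A i \<inter> A j = {}"
      by (intro ballI impI disj)
  qed simp
  also have "\<dots> = (\<Sum>i\<in>{1..3}. net_variation f (?E ` S_part n1 n2 b S i) (P i))"
    by (rule sum.cong[OF refl net[symmetric]])
  finally show ?thesis by (simp only: add_0_right)
qed

theorem lemma5p1:
  fixes n1 n2 b n s :: nat and S :: "nat set" and P :: "nat \<Rightarrow> nat list"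
    and d :: "nat \<Rightarrow> nat \<Rightarrow> nat" and u :: "nat \<Rightarrow> nat \<Rightarrow> int" and K :: real
  defines "n \<equiv> n1 + n2" and "s \<equiv> card S"
    and "K \<equiv> (\<Sum>i\<in>{1..3}. 1 / real (d i 1)
           + (\<Sum>j\<in>{2..card (S_part n1 n2 b S i)}.
                1 / real_of_int (u i j) + 1 / (real (d i j) - real_of_int (u i j)))
           + 1 / real (d i (card (S_part n1 n2 b S i) + 1)))"
  assumes "1 \<le> b" and "b < n1" and "1 \<le> n2"
    and "S \<subseteq> {2..n}"
    and "admissible_decomposition n1 n2 b S P d"
    and "\<forall>i\<in>{1..3}. \<forall>j\<in>{2..card (S_part n1 n2 b S i)}. 2 \<le> u i j \<and> u i j \<le> int (d i j) - 2"
  shows "kappa_sq n1 n2 b S \<ge> (real s + 1) / real n * (1 / K)"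
proof -
  define k where "k i = card (S_part n1 n2 b S i)" for i
  define T where "T i = edge n1 b ` S_part n1 n2 b S i" for i
  define w where "w i = 1 / real (d i 1)
      + (\<Sum>j\<in>{2..k i}. 1 / real_of_int (u i j) + 1 / (real (d i j) - real_of_int (u i j)))
      + 1 / real (d i (k i + 1))" for i
  have K: "K = (\<Sum>i\<in>{1..3}. w i)" by (simp add: K_def w_def k_def)
  note adm = assms(8)[unfolded admissible_decomposition_def, folded k_def T_def]
  have k1: "\<forall>i\<in>{1..3}. 1 \<le> k i"
    using adm by (elim conjE)
  have path: "\<forall>i\<in>{1..3}. is_path {1..n1 + n2} (branched_edges n1 n2 b) (P i)"
    using adm by (elim conjE)
  have lens: "\<forall>i\<in>{1..3}. map (d i) [1..<k i + 2] = map length (segments (T i) (P i))"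
    using adm by (elim conjE)
  have disj: "disjoint_family_on (\<lambda>i. set (P i)) {1..3}"
    using adm by (elim conjE)
  have cover: "(\<Union>i\<in>{1..3}. set (P i)) = {1..n}"
    unfolding n_def using adm by (elim conjE)
  have d1: "\<forall>i\<in>{1..3}. 2 \<le> d i 1 \<and> 2 \<le> d i (k i + 1) \<and> (\<forall>j\<in>{2..k i}. 4 \<le> d i j)"
    using adm by (elim conjE)
  have u: "0 < u i j \<and> u i j < int (d i j)" if "i \<in> {1..3}" "j \<in> {2..k i}" for i j
    using assms(9) that unfolding k_def by fastforce
  have "0 < w i" if i: "i \<in> {1..3}" for i
  proof -
    have "0 < 1 / real (d i 1)" using d1 i by fastforce
    moreover have "0 \<le> (\<Sum>j\<in>{2..k i}. 1 / real_of_int (u i j) + 1 / (real (d i j) - real_of_int (u i j)))"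
    proof (intro sum_nonneg)
      fix j assume "j \<in> {2..k i}"
      from u[OF i this] have "0 < real_of_int (u i j)" "real_of_int (u i j) < real (d i j)"
        by linarith+
      then show "0 \<le> 1 / real_of_int (u i j) + 1 / (real (d i j) - real_of_int (u i j))" by simp
    qed
    ultimately show ?thesis unfolding w_def by (simp add: add_pos_nonneg)
  qed
  then have K0: "0 < K" unfolding K by (intro sum_pos) auto
  have "1 \<le> k 1" using k1 by simp
  then have "S \<noteq> {}" by (auto simp: k_def S_part_def)
  then have "kappa_sq n1 n2 b S \<in> kappa_values n1 n2 b S"
    using kappa_sq_is_minimum(1)[OF assms(4-6)] assms(7) by (simp add: n_def)
  then obtain \<beta> where \<beta>: "l1_on S \<beta> - l1_on ({1..n} - ({1} \<union> S)) \<beta> = 1"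
    and kap: "kappa_sq n1 n2 b S = real (s + 1) * norm_n_sq n (mat_vec n (path_matrix n1 n2 b) \<beta>)"
    unfolding kappa_values_def n_def s_def by blast
  define f where "f = mat_vec n (path_matrix n1 n2 b) \<beta>"
  define Q where "Q = (\<Sum>i\<in>{1..n}. (f i)\<^sup>2)"
  have step: "f e - f (parent n1 b e) = \<beta> e" if "e \<in> {2..n}" for e
    using mat_vec_step[OF assms(4-6), of e \<beta>] that by (simp add: f_def n_def)
  have "1 \<le> (\<Sum>i\<in>{1..3}. net_variation f (T i) (P i))"
    unfolding \<beta>[symmetric] T_def n_def
    by (rule excess_le_net_variations[where d = d])
       (use assms(4,5,7,8) step in \<open>simp_all add: n_def\<close>)
  then have "2 \<le> (\<Sum>i\<in>{1..3}. 2 * net_variation f (T i) (P i))"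
    by (simp flip: sum_distrib_left)
  \<comment> \<open>The one-path bound with \<open>c = 1 / K\<close>, so that the costs of the three paths sum to \<open>1\<close>.\<close>
  also have "\<dots> \<le> (\<Sum>i\<in>{1..3}. 1 / K * w i + (\<Sum>x\<in>set (P i). (f x)\<^sup>2) / (1 / K))"
  proof (intro sum_mono)
    fix i :: nat assume i: "i \<in> {1..3}"
    have "P i \<noteq> []" "distinct (P i)" "1 \<le> k i"
      "map (d i) [1..<k i + 2] = map length (segments (T i) (P i))"
      using path k1 lens i by (simp_all add: is_path_def del: upt_Suc)
    then show "2 * net_variation f (T i) (P i)
        \<le> 1 / K * w i + (\<Sum>x\<in>set (P i). (f x)\<^sup>2) / (1 / K)"
      unfolding w_def using K0 u[OF i] by (intro net_variation_le) auto
  qed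
  also have "\<dots> = 1 / K * K + (\<Sum>i\<in>{1..3}. \<Sum>x\<in>set (P i). (f x)\<^sup>2) / (1 / K)"
    by (simp only: sum.distrib sum_distrib_left[symmetric] sum_divide_distrib[symmetric] K)
  also have "(\<Sum>i\<in>{1..3}. \<Sum>x\<in>set (P i). (f x)\<^sup>2) = (\<Sum>x\<in>(\<Union>i\<in>{1..3}. set (P i)). (f x)\<^sup>2)"
    using disj unfolding disjoint_family_on_def by (intro sum.UNION_disjoint[symmetric]) auto
  also have "(\<Union>i\<in>{1..3}. set (P i)) = {1..n}"
    by (rule cover)
  finally have "1 \<le> Q * K" using K0 by (simp add: Q_def)
  then have "1 / K \<le> Q" using K0 by (simp add: pos_divide_le_eq)
  then have "(real s + 1) / real n * (1 / K) \<le> (real s + 1) / real n * Q"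
    by (intro mult_left_mono) auto
  also have "\<dots> = kappa_sq n1 n2 b S"
    unfolding kap f_def[symmetric] norm_n_sq_def Q_def by (simp add: add.commute)
  finally show ?thesis .
qed

end
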